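(* Let $D_n=\langle a,b\mid a^n=b^2=1,\ ab=ba^{-1}\rangle$ ($n\ge3$). (i) If $n=p^\alpha\ge3$ with $p$ prime and $\alpha\ge1$, then $\Gamma(D_n)$ is Hamiltonian iff $p=2$ and $\alpha\ge2$. (ii) If $n=pq$ with $p,q$ distinct primes and $p<q$, then $\Gamma(D_n)$ is Hamiltonian iff $p=2$ and $q\le5$.
   Context: For a group $G$, $\Gamma(G)$ is the simple graph whose vertices are the subgroups of $G$ other than $\{1\}$ and $G$, two distinct vertices $H,K$ being adjacent iff $HK=KH$. A graph is Hamiltonian if it has a cycle through all its vertices. *)

theory Defs
  imports
    "HOL-Algebra.Coset"
    "HOL-Computational_Algebra.Primes"
    "Graph_Theory.Pair_Digraph"
begin

section \<open>Groups given by generators and relations\<close>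

datatype 'g letter = Gen 'g | Inv 'g

fun inv_letter :: "'g letter \<Rightarrow> 'g letter" where
  "inv_letter (Gen x) = Inv x"
| "inv_letter (Inv x) = Gen x"

text \<open>
  The least congruence on words in the letters \<open>x\<close>, \<open>x\<inverse>\<close> that cancels mutually inverse
  adjacent letters and identifies both sides of each relation; a pair \<open>(u, v)\<close> in \<open>R\<close>
  stands for the relation \<open>u = v\<close>.
\<close>

inductive word_eq :: "('g letter list \<times> 'g letter list) set \<Rightarrow> 'g letter list \<Rightarrow> 'g letter list \<Rightarrow> bool"
  for R where
  refl: "word_eq R u u"
| sym: "word_eq R u v \<Longrightarrow> word_eq R v u"
| trans: "word_eq R u v \<Longrightarrow> word_eq R v w \<Longrightarrow> word_eq R u w"
| append: "word_eq R u u' \<Longrightarrow> word_eq R v v' \<Longrightarrow> word_eq R (u @ v) (u' @ v')"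
| cancel: "word_eq R [x, inv_letter x] []"
| rel: "(u, v) \<in> R \<Longrightarrow> word_eq R u v"

definition word_class :: "('g letter list \<times> 'g letter list) set \<Rightarrow> 'g letter list \<Rightarrow> 'g letter list set" where
  "word_class R u = {v. word_eq R u v}"

definition presented_group :: "('g letter list \<times> 'g letter list) set \<Rightarrow> 'g letter list set monoid" where
  "presented_group R =
     \<lparr> carrier = range (word_class R),
       monoid.mult = (\<lambda>U V. \<Union>u\<in>U. \<Union>v\<in>V. word_class R (u @ v)),
       monoid.one = word_class R [] \<rparr>"

lemma word_class_eq_iff: "word_class R u = word_class R v \<longleftrightarrow> word_eq R u v"
  unfolding word_class_def by (blast intro: word_eq.refl word_eq.sym word_eq.trans)

lemma presented_group_mult:
  "word_class R u \<otimes>\<^bsub>presented_group R\<^esub> word_class R v = word_class R (u @ v)"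
  unfolding presented_group_def word_class_def
  by (auto intro: word_eq.refl word_eq.trans word_eq.append)

lemma word_eq_inverse: "word_eq R (rev (map inv_letter u) @ u) []"
proof (induction u)
  case Nil
  show ?case by (simp add: word_eq.refl)
next
  case (Cons x u)
  have "word_eq R [inv_letter x, x] []"
    using word_eq.cancel[of R "inv_letter x"] by (cases x) auto
  then have "word_eq R (rev (map inv_letter u) @ [inv_letter x, x] @ u) (rev (map inv_letter u) @ [] @ u)"
    by (intro word_eq.append word_eq.refl)
  with Cons.IH show ?case by (auto intro: word_eq.trans)
qed

lemma group_presented_group: "group (presented_group R)"
proof -
  have car: "carrier (presented_group R) = range (word_class R)"
    and one: "\<one>\<^bsub>presented_group R\<^esub> = word_class R []"
    by (simp_all add: presented_group_def)
  have inverse: "\<exists>v. word_class R (v @ u) = word_class R []" for u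
    using word_eq_inverse word_class_eq_iff by blast
  show ?thesis
    by (rule groupI) (use inverse in \<open>auto simp: car one presented_group_mult\<close>)
qed

section \<open>The dihedral group of order \<open>2n\<close>\<close>

datatype dihedral_gen = a | b

definition dihedral_group :: "nat \<Rightarrow> dihedral_gen letter list set monoid" where
  "dihedral_group n = presented_group
     {(replicate n (Gen a), []), ([Gen b, Gen b], []), ([Gen a, Gen b], [Gen b, Inv a])}"

hide_const (open) a b

section \<open>The graph of permuting subgroups\<close>

text \<open>
  As usual in \<^theory>\<open>Graph_Theory.Digraph\<close>, a simple graph is a symmetric loop-free digraph
  without parallel arcs: each edge is represented by the two opposite arcs.
\<close>

definition permuting_subgroups_graph :: "('a, 'm) monoid_scheme \<Rightarrow> 'a set pair_pre_digraph" where
  "permuting_subgroups_graph G =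
     (let V = {H. subgroup H G \<and> H \<noteq> {\<one>\<^bsub>G\<^esub>} \<and> H \<noteq> carrier G} in
     \<lparr> pverts = V,
       parcs = {(H, K). H \<in> V \<and> K \<in> V \<and> H \<noteq> K \<and> H <#>\<^bsub>G\<^esub> K = K <#>\<^bsub>G\<^esub> H} \<rparr>)"

lemma pair_graph_permuting_subgroups_graph:
  assumes "finite (carrier G)"
  shows "pair_graph (permuting_subgroups_graph G)"
proof -
  let ?V = "pverts (permuting_subgroups_graph G)"
  have "?V \<subseteq> Pow (carrier G)"
    by (auto simp: permuting_subgroups_graph_def Let_def dest: subgroup.subset)
  then have fin: "finite ?V"
    using assms by (meson finite_Pow_iff finite_subset)
  moreover have "parcs (permuting_subgroups_graph G) \<subseteq> ?V \<times> ?V"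
    by (auto simp: permuting_subgroups_graph_def Let_def)
  ultimately have "finite (parcs (permuting_subgroups_graph G))"
    by (meson finite_SigmaI finite_subset)
  with fin show ?thesis
    by unfold_locales
      (auto simp: permuting_subgroups_graph_def Let_def symmetric_def intro!: symI)
qed

text \<open>
  A cycle is a list of arcs with pairwise distinct tails. The length bound excludes the closed
  walk \<open>u, v, u\<close>, which is a cycle of the symmetric digraph but not of the undirected graph.
\<close>

definition hamiltonian :: "'a pair_pre_digraph \<Rightarrow> bool" where
  "hamiltonian G \<longleftrightarrow>
     (\<exists>p. pre_digraph.cycle (with_proj G) p \<and> 3 \<le> length p \<and> fst ` set p = pverts G)"

end

theory Submission
  imports Defs
begin

text \<open>
  For \<open>d\<close> dividing \<open>n\<close>, the subgroup \<open>\<langle>a\<^sup>d\<rangle>\<close> is normal, and \<open>\<langle>a\<^sup>d, a\<^sup>ib\<rangle>\<close> and \<open>\<langle>a\<^sup>e, a\<^sup>jb\<rangle>\<close> permute iff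
  \<open>gcd d e\<close> divides \<open>2 (i - j)\<close>. For odd \<open>n\<close>, the \<open>n\<close> subgroups of order 2 generated by reflections
  are thus pairwise nonadjacent, and for \<open>n = p\<^sup>\<alpha>\<close> or \<open>n = pq\<close> they are more than half of all
  vertices, so there is no Hamiltonian cycle. For \<open>n = 2q\<close>, five vertices are adjacent to all others
  and the remaining ones form \<open>q\<close> disjoint triangles, so a Hamiltonian cycle exists iff \<open>q \<le> 5\<close>.
  For \<open>n = 2\<^sup>\<alpha>\<close>, the subgroups \<open>\<langle>a\<^sup>d, a\<^sup>ib\<rangle>\<close> form a binary tree whose preorder traversal is a path,
  and the subgroups \<open>\<langle>a\<^sup>d\<rangle>\<close> close it to a cycle.
\<close>

section \<open>Elements of the dihedral group\<close>

text \<open>The pair \<open>(i, s)\<close> encodes \<open>a\<^sup>i\<close> if \<open>\<not> s\<close> and \<open>a\<^sup>ib\<close> if \<open>s\<close>, in the infinite dihedral group.\<close>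

fun dihedral_eval :: "dihedral_gen letter list \<Rightarrow> int \<times> bool" where
  "dihedral_eval [] = (0, False)"
| "dihedral_eval (Gen dihedral_gen.a # u) = (fst (dihedral_eval u) + 1, snd (dihedral_eval u))"
| "dihedral_eval (Inv dihedral_gen.a # u) = (fst (dihedral_eval u) - 1, snd (dihedral_eval u))"
| "dihedral_eval (Gen dihedral_gen.b # u) = (- fst (dihedral_eval u), \<not> snd (dihedral_eval u))"
| "dihedral_eval (Inv dihedral_gen.b # u) = (- fst (dihedral_eval u), \<not> snd (dihedral_eval u))"

text \<open>Evaluation is a homomorphism to the infinite dihedral group: moving a power of
  \<open>a\<close> past a reflection changes the sign of its exponent.\<close>

lemma dihedral_eval_append:
  "dihedral_eval (u @ v) =
     (fst (dihedral_eval u) + (if snd (dihedral_eval u) then - fst (dihedral_eval v) else fst (dihedral_eval v)),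
      snd (dihedral_eval u) \<noteq> snd (dihedral_eval v))"
  by (induction u rule: dihedral_eval.induct) auto

lemma dihedral_eval_replicate:
  "dihedral_eval (replicate k (Gen dihedral_gen.a)) = (int k, False)"
  "dihedral_eval (replicate k (Inv dihedral_gen.a)) = (- int k, False)"
  by (induction k) auto

section \<open>Normal forms in the presented group\<close>

abbreviation dihedral_relations :: "nat \<Rightarrow> (dihedral_gen letter list \<times> dihedral_gen letter list) set" where
  "dihedral_relations n \<equiv>
     {(replicate n (Gen dihedral_gen.a), []), ([Gen dihedral_gen.b, Gen dihedral_gen.b], []),
      ([Gen dihedral_gen.a, Gen dihedral_gen.b], [Gen dihedral_gen.b, Inv dihedral_gen.a])}"

text \<open>This invariant separates the normal forms: the relations hold in the infinite dihedral
  group up to multiples of \<open>n\<close> in the exponent, so words that differ modulo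
  \<open>n\<close> stay distinct in the presented group.\<close>

lemma dihedral_eval_cong:
  assumes "word_eq (dihedral_relations n) u v"
  shows "int n dvd fst (dihedral_eval u) - fst (dihedral_eval v) \<and>
         snd (dihedral_eval u) = snd (dihedral_eval v)"
  using assms
proof (induction rule: word_eq.induct)
  case (sym u v)
  then show ?case using dvd_diff_commute by blast
next
  case (trans u v w)
  then have "int n dvd (fst (dihedral_eval u) - fst (dihedral_eval v)) + (fst (dihedral_eval v) - fst (dihedral_eval w))"
    by (intro dvd_add) auto
  with trans show ?case by simp
next
  case (append u u' v v')
  \<comment> \<open>Which of the two combinations is needed depends on whether \<open>u\<close>
    evaluates to a reflection, since that flips the sign of the exponent coming from
    \<open>v\<close>.\<close>
  have "int n dvd (fst (dihedral_eval u) - fst (dihedral_eval u')) + (fst (dihedral_eval v) - fst (dihedral_eval v'))"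
       "int n dvd (fst (dihedral_eval u) - fst (dihedral_eval u')) - (fst (dihedral_eval v) - fst (dihedral_eval v'))"
    using append by (blast intro: dvd_add dvd_diff)+
  with append show ?case by (auto simp: dihedral_eval_append algebra_simps)
next
  case (cancel x)
  show ?case
    by (cases x; cases "case x of Gen y \<Rightarrow> y | Inv y \<Rightarrow> y") auto
qed (auto simp: dihedral_eval_replicate)

text \<open>The arguments about subgroups use only this multiplication table. Exponents range over
  all integers instead of residues, so that subgroups are cut out by congruences; only the equality
  rules reduce modulo \<open>n\<close>.\<close>

locale dihedral = group G for G (structure) +
  fixes n :: nat and rot ref :: "int \<Rightarrow> 'a"
  assumes n_pos: "n > 0"
    and carrier_eq: "carrier G = range rot \<union> range ref"
    and rot_rot: "rot i \<otimes> rot j = rot (i + j)"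
    and rot_ref: "rot i \<otimes> ref j = ref (i + j)"
    and ref_rot: "ref i \<otimes> rot j = ref (i - j)"
    and ref_ref: "ref i \<otimes> ref j = rot (i - j)"
    and rot_eq_iff: "rot i = rot j \<longleftrightarrow> int n dvd i - j"
    and ref_eq_iff: "ref i = ref j \<longleftrightarrow> int n dvd i - j"
    and rot_neq_ref: "rot i \<noteq> ref j"

text \<open>The relations bring each word to the form \<open>a^i b^s\<close>, and
  \<open>dihedral_eval_cong\<close> shows that two such forms agree only if \<open>s\<close> agrees
  and \<open>i\<close> agrees modulo \<open>n\<close>. Products of normal forms are then read off
  from \<open>dihedral_eval_append\<close>.\<close>

lemma dihedral_dihedral_group:
  assumes "n > 0"
  shows "\<exists>rot ref. dihedral (dihedral_group n) n rot ref"
proof -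
  let ?R = "dihedral_relations n" and ?G = "dihedral_group n"
  define cl where "cl = word_class ?R"
  have G_def: "?G = presented_group ?R" by (simp add: dihedral_group_def)
  interpret group ?G unfolding G_def by (rule group_presented_group)
  have car: "carrier ?G = range cl" and one: "\<one>\<^bsub>?G\<^esub> = cl []"
    by (simp_all add: G_def presented_group_def cl_def)
  have mult: "cl u \<otimes>\<^bsub>?G\<^esub> cl v = cl (u @ v)" for u v
    unfolding G_def cl_def by (rule presented_group_mult)
  have cl_eq: "cl u = cl v \<longleftrightarrow> word_eq ?R u v" for u v
    unfolding cl_def by (rule word_class_eq_iff)
  define A where "A = cl [Gen dihedral_gen.a]"
  define B where "B = cl [Gen dihedral_gen.b]"
  have AB [simp]: "A \<in> carrier ?G" "B \<in> carrier ?G" by (auto simp: car A_def B_def)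
  have invA: "cl [Inv dihedral_gen.a] = inv\<^bsub>?G\<^esub> A"
  proof (rule inv_equality [symmetric])
    show "cl [Inv dihedral_gen.a] \<otimes>\<^bsub>?G\<^esub> A = \<one>\<^bsub>?G\<^esub>"
      using word_eq.cancel[of ?R "Inv dihedral_gen.a"] by (simp add: A_def mult one cl_eq)
  qed (auto simp: car A_def)
  have BB: "B \<otimes>\<^bsub>?G\<^esub> B = \<one>\<^bsub>?G\<^esub>"
    by (simp add: B_def mult one cl_eq word_eq.rel)
  have invB: "inv\<^bsub>?G\<^esub> B = B" using BB by (simp add: inv_equality)
  have invB': "cl [Inv dihedral_gen.b] = B"
  proof -
    have "cl [Inv dihedral_gen.b] \<otimes>\<^bsub>?G\<^esub> B = \<one>\<^bsub>?G\<^esub>"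
      using word_eq.cancel[of ?R "Inv dihedral_gen.b"] by (simp add: B_def mult one cl_eq)
    then have "inv\<^bsub>?G\<^esub> B = cl [Inv dihedral_gen.b]"
      by (rule inv_equality) (auto simp: car B_def)
    with invB show ?thesis by simp
  qed
  have AB_BA: "A \<otimes>\<^bsub>?G\<^esub> B = B \<otimes>\<^bsub>?G\<^esub> inv\<^bsub>?G\<^esub> A"
    by (simp add: A_def B_def mult cl_eq word_eq.rel flip: invA[unfolded A_def])
  have BA: "B \<otimes>\<^bsub>?G\<^esub> A = inv\<^bsub>?G\<^esub> A \<otimes>\<^bsub>?G\<^esub> B"
  proof -
    \<comment> \<open>The relation gives \<open>A B A = B A^-1 A = B\<close>; solve this for
      \<open>B A\<close>.\<close>
    have "B = A \<otimes>\<^bsub>?G\<^esub> (B \<otimes>\<^bsub>?G\<^esub> A)"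
      by (simp add: AB_BA m_assoc flip: m_assoc [of A])
    then show ?thesis by (simp add: inv_solve_left)
  qed
  have conj: "B \<otimes>\<^bsub>?G\<^esub> (A [^]\<^bsub>?G\<^esub> i) = A [^]\<^bsub>?G\<^esub> (- i) \<otimes>\<^bsub>?G\<^esub> B" for i :: int
  proof (induction i rule: int_induct [where k = 0])
    case base
    show ?case by simp
  next
    case (step1 i)
    have "B \<otimes>\<^bsub>?G\<^esub> (A [^]\<^bsub>?G\<^esub> (i + 1)) = A [^]\<^bsub>?G\<^esub> (- i) \<otimes>\<^bsub>?G\<^esub> (B \<otimes>\<^bsub>?G\<^esub> A)"
      using step1 by (simp add: int_pow_mult int_pow_1 flip: m_assoc)
    also have "\<dots> = A [^]\<^bsub>?G\<^esub> (- i + - 1) \<otimes>\<^bsub>?G\<^esub> B"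
      by (simp only: int_pow_mult [OF AB(1)]) (simp add: BA int_pow_neg int_pow_1 m_assoc)
    finally show ?case by simp
  next
    case (step2 i)
    have "B \<otimes>\<^bsub>?G\<^esub> (A [^]\<^bsub>?G\<^esub> (i + - 1)) = A [^]\<^bsub>?G\<^esub> (- i) \<otimes>\<^bsub>?G\<^esub> (B \<otimes>\<^bsub>?G\<^esub> inv\<^bsub>?G\<^esub> A)"
      using step2 by (simp only: int_pow_mult [OF AB(1)]) (simp add: int_pow_neg int_pow_1 flip: m_assoc)
    also have "\<dots> = A [^]\<^bsub>?G\<^esub> (- i + 1) \<otimes>\<^bsub>?G\<^esub> B"
      by (simp only: int_pow_mult [OF AB(1)]) (simp add: int_pow_1 m_assoc flip: AB_BA)
    finally show ?case by simp
  qed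
  \<comment> \<open>\<open>el\<close> interprets a pair inside the presented group;
    \<open>cl_el\<close> then shows, letter by letter, that every word equals the normal form of its
    evaluation.\<close>
  define el where "el = (\<lambda>(i :: int, s). A [^]\<^bsub>?G\<^esub> i \<otimes>\<^bsub>?G\<^esub> (if s then B else \<one>\<^bsub>?G\<^esub>))"
  have el_closed: "el p \<in> carrier ?G" for p
    by (auto simp: el_def split: prod.splits)
  have shift: "A [^]\<^bsub>?G\<^esub> k \<otimes>\<^bsub>?G\<^esub> el (i, s) = el (k + i, s)" for k i s
    by (simp add: el_def int_pow_mult m_assoc)
  have cl_el: "cl u = el (dihedral_eval u)" for u
  proof (induction u rule: dihedral_eval.induct)
    case 1
    show ?case by (simp add: el_def one mult)
  next
    case (2 u)
    have "cl (Gen dihedral_gen.a # u) = A [^]\<^bsub>?G\<^esub> (1 :: int) \<otimes>\<^bsub>?G\<^esub> cl u"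
      by (simp add: A_def mult int_pow_1 car)
    with 2 shift[of 1 "fst (dihedral_eval u)" "snd (dihedral_eval u)"] show ?case
      by (simp add: add.commute)
  next
    case (3 u)
    have "cl (Inv dihedral_gen.a # u) = A [^]\<^bsub>?G\<^esub> (- 1 :: int) \<otimes>\<^bsub>?G\<^esub> cl u"
      by (simp add: int_pow_neg int_pow_1 mult flip: invA)
    also have "\<dots> = el (- 1 + fst (dihedral_eval u), snd (dihedral_eval u))"
      using shift[of "- 1" "fst (dihedral_eval u)" "snd (dihedral_eval u)"] by (simp only: 3 prod.collapse)
    finally show ?case by simp
  next
    case (4 u)
    have "cl (Gen dihedral_gen.b # u) = B \<otimes>\<^bsub>?G\<^esub> el (dihedral_eval u)"
      by (simp add: B_def mult flip: 4)
    also have "\<dots> = el (- fst (dihedral_eval u), \<not> snd (dihedral_eval u))"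
      by (simp add: el_def split_def conj m_assoc BB flip: m_assoc [of B])
    finally show ?case by simp
  next
    case (5 u)
    have "cl (Inv dihedral_gen.b # u) = B \<otimes>\<^bsub>?G\<^esub> el (dihedral_eval u)"
      by (simp add: mult flip: 5 invB')
    also have "\<dots> = el (- fst (dihedral_eval u), \<not> snd (dihedral_eval u))"
      by (simp add: el_def split_def conj m_assoc BB flip: m_assoc [of B])
    finally show ?case by simp
  qed
  have "\<exists>u. dihedral_eval u = p" for p
  proof (cases p)
    case (Pair i s)
    let ?u = "(if i \<ge> 0 then replicate (nat i) (Gen dihedral_gen.a) else replicate (nat (- i)) (Inv dihedral_gen.a))
              @ (if s then [Gen dihedral_gen.b] else [])"
    have "dihedral_eval ?u = p"
      by (auto simp: Pair dihedral_eval_append dihedral_eval_replicate)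
    then show ?thesis by blast
  qed
  \<comment> \<open>\<open>w\<close> picks a word for every pair, so that facts about words transfer
    to \<open>el\<close>.\<close>
  then obtain w where w: "dihedral_eval (w p) = p" for p by metis
  have el_cl: "el p = cl (w p)" for p by (simp add: cl_el w)
  have el_mult: "el p \<otimes>\<^bsub>?G\<^esub> el q = el (fst p + (if snd p then - fst q else fst q), snd p \<noteq> snd q)" for p q
  proof -
    have "el p \<otimes>\<^bsub>?G\<^esub> el q = cl (w p @ w q)" by (simp add: el_cl mult)
    also have "\<dots> = el (dihedral_eval (w p @ w q))" by (rule cl_el)
    finally show ?thesis by (simp add: dihedral_eval_append w)
  qed
  have An: "A [^]\<^bsub>?G\<^esub> int n = \<one>\<^bsub>?G\<^esub>"
  proof -
    have "cl (replicate n (Gen dihedral_gen.a)) = cl []"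
      unfolding cl_eq by (rule word_eq.rel) simp
    then show ?thesis
      by (simp add: cl_el dihedral_eval_replicate el_def)
  qed
  have el_eq: "el (i, s) = el (j, t) \<longleftrightarrow> int n dvd i - j \<and> s = t" for i j s t
  proof
    assume "el (i, s) = el (j, t)"
    then show "int n dvd i - j \<and> s = t"
      using dihedral_eval_cong[of n "w (i, s)" "w (j, t)"] by (simp add: el_cl cl_eq w)
  next
    assume *: "int n dvd i - j \<and> s = t"
    then obtain k where "i = j + int n * k" by (metis dvd_def diff_add_cancel add.commute)
    then have "A [^]\<^bsub>?G\<^esub> i = A [^]\<^bsub>?G\<^esub> j"
      by (simp add: int_pow_mult An flip: int_pow_pow)
    with * show "el (i, s) = el (j, t)" by (simp add: el_def)
  qed
  have "carrier ?G = range el"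
    using el_closed by (auto simp: car cl_el)
  also have "\<dots> = range (\<lambda>i. el (i, False)) \<union> range (\<lambda>i. el (i, True))"
    by (auto simp: image_iff) (metis (full_types))
  finally have "dihedral ?G n (\<lambda>i. el (i, False)) (\<lambda>i. el (i, True))"
    using assms by unfold_locales (auto simp: el_mult el_eq)
  then show ?thesis by blast
qed

section \<open>Hamiltonian cycles\<close>

text \<open>Cycles are given as lists of arcs. Pairing each vertex of \<open>xs\<close> with its
  successor turns a vertex list into such a walk with final vertex \<open>w\<close>; taking
  \<open>w = hd xs\<close> closes it.\<close>

lemma pawalk_zip:
  assumes "xs \<noteq> []"
  shows "pcas (hd xs) (zip xs (tl xs @ [w])) w"
    and "pawalk_verts (hd xs) (zip xs (tl xs @ [w])) = xs @ [w]"
  using assms by (induction xs rule: list_nonempty_induct) (auto simp: neq_Nil_conv)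

lemma hamiltonianI:
  assumes xs: "distinct xs" "set xs = pverts G" "length xs \<ge> 3"
    and path: "successively (\<lambda>x y. (x, y) \<in> parcs G) xs"
    and closing: "(last xs, hd xs) \<in> parcs G"
  shows "hamiltonian G"
proof -
  let ?p = "zip xs (tl xs @ [hd xs])"
  from xs have ne: "xs \<noteq> []" by auto
  have len: "length (tl xs @ [hd xs]) = length xs" using ne by simp
  have arc: "(xs ! i, (tl xs @ [hd xs]) ! i) \<in> parcs G" if "i < length xs" for i
  proof (cases "Suc i < length xs")
    case True
    with successively_nth[OF path True] show ?thesis by (simp add: nth_append nth_tl less_diff_conv)
  next
    case False
    with that have i: "i = length (tl xs)" by simp
    have "xs ! i = last xs" unfolding i using ne by (simp add: last_conv_nth)
    moreover have "(tl xs @ [hd xs]) ! i = hd xs" unfolding i by (rule nth_append_length)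
    ultimately show ?thesis using closing by simp
  qed
  have "set ?p \<subseteq> parcs G"
    using arc by (auto simp: set_zip simp del: length_append)
  moreover have "distinct (tl (pawalk_verts (hd xs) ?p))"
    unfolding pawalk_zip(2)[OF ne] using xs(1) ne by (cases xs) auto
  moreover have "pcas (hd xs) ?p (hd xs)" using ne by (rule pawalk_zip)
  moreover have "fst ` set ?p = pverts G"
  proof -
    have "map fst ?p = xs" using len by simp
    with xs(2) show ?thesis by (metis set_map)
  qed
  moreover have "3 \<le> length ?p" using xs(3) len by simp
  moreover have "hd xs \<in> pverts G" using hd_in_set[OF ne] xs(2) by simp
  moreover have "?p \<noteq> []" using \<open>3 \<le> length ?p\<close> by fastforce
  ultimately have "pre_digraph.cycle (with_proj G) ?p"
    unfolding pre_digraph.cycle_def pre_digraph.awalk_def cas_with_proj_eq awalk_verts_with_proj_eq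
    by auto
  with \<open>3 \<le> length ?p\<close> \<open>fst ` set ?p = pverts G\<close> show ?thesis
    unfolding hamiltonian_def by blast
qed

section \<open>Consequences of a Hamiltonian cycle\<close>

lemma pcas_nth:
  assumes "pcas u p v" "i < length p"
  shows "snd (p ! i) = (if Suc i = length p then v else fst (p ! Suc i))"
  using assms
proof (induction p arbitrary: u i)
  case (Cons e p)
  then show ?case by (cases i; cases p) auto
qed simp

lemma pawalk_verts_eq: "pcas u p v \<Longrightarrow> pawalk_verts u p = u # map snd p"
  by (induction p arbitrary: u) auto

text \<open>Extending the cycle periodically to all indices removes the wrap-around. Injectivity
  concerns \<open>x (Suc i)\<close> because the definition of a cycle requires distinctness of the
  vertex list without its first entry, that is, of the heads of the arcs.\<close>

lemma hamiltonianE: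
  assumes "hamiltonian G"
  obtains m x where "m > 0" "\<And>i. x i \<in> pverts G" "\<And>i. (x i, x (Suc i)) \<in> parcs G"
    "x ` {..<m} = pverts G" "inj_on (\<lambda>i. x (Suc i)) {..<m}" "\<And>i. x (i + m) = x i"
proof -
  from assms obtain p u where p: "fst ` set p = pverts G" "set p \<subseteq> parcs G" "p \<noteq> []"
    and cas: "pcas u p u" and dist: "distinct (tl (pawalk_verts u p))"
    unfolding hamiltonian_def pre_digraph.cycle_def pre_digraph.awalk_def
      cas_with_proj_eq awalk_verts_with_proj_eq by auto
  define m where "m = length p"
  define x where "x i = fst (p ! (i mod m))" for i
  have m: "m > 0" using p by (simp add: m_def)
  have u: "u = x 0" using cas p(3) by (cases p) (auto simp: x_def m_def)
  have step: "snd (p ! (i mod m)) = x (Suc i)" for i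
    using pcas_nth[OF cas, of "i mod m"] m u by (auto simp: m_def x_def mod_Suc)
  have mem: "p ! (i mod m) \<in> set p" for i
    using m by (simp add: m_def)
  show ?thesis
  proof (rule that[of m x])
    show "m > 0" by fact
    show arc: "(x i, x (Suc i)) \<in> parcs G" for i
      using p(2) mem[of i] unfolding step[symmetric] by (auto simp: x_def)
    show "x i \<in> pverts G" for i
      unfolding p(1)[symmetric] x_def using mem by (rule imageI)
    show "x ` {..<m} = pverts G"
      unfolding p(1)[symmetric] by (auto simp: x_def m_def set_conv_nth image_iff)
    show "inj_on (\<lambda>i. x (Suc i)) {..<m}"
    proof (rule inj_onI)
      fix i j assume ij: "i \<in> {..<m}" "j \<in> {..<m}" and "x (Suc i) = x (Suc j)"
      then have "map snd p ! i = map snd p ! j"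
        using step[of i] step[of j] by (simp add: m_def)
      with dist ij show "i = j"
        unfolding pawalk_verts_eq[OF cas] list.sel
        using nth_eq_iff_index_eq[of "map snd p" i j] by (simp add: m_def)
    qed
    show "x (i + m) = x i" for i by (simp add: x_def)
  qed
qed

text \<open>Each colour class is left by the cycle at some point, and can only be left into \<open>S\<close>.\<close>

lemma hamiltonian_card_le:
  assumes "hamiltonian G" and S: "S \<subseteq> pverts G" "S \<noteq> {}" "finite S"
    and colour: "\<And>x y. (x, y) \<in> parcs G \<Longrightarrow> x \<notin> S \<Longrightarrow> y \<notin> S \<Longrightarrow> c x = c y"
  shows "card (c ` (pverts G - S)) \<le> card S"
proof -
  from assms(1) obtain m x where m: "m > 0" and x: "\<And>i. x i \<in> pverts G" "\<And>i. (x i, x (Suc i)) \<in> parcs G"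
    "x ` {..<m} = pverts G" "inj_on (\<lambda>i. x (Suc i)) {..<m}" "\<And>i. x (i + m) = x i"
    by (rule hamiltonianE) blast
  have x_mod: "x (i mod m) = x i" for i
  proof -
    have "x (i + k * m) = x i" for i k
    proof (induction k)
      case (Suc k)
      then show ?case using x(5)[of "i + k * m"] by (simp add: add_ac)
    qed simp
    from this[of "i mod m" "i div m"] show ?thesis by simp
  qed
  \<comment> \<open>\<open>?I\<close> collects the positions from which the cycle enters
    \<open>S\<close>; each colour outside \<open>S\<close> is shown to occur at one of them.\<close>
  let ?I = "{i \<in> {..<m}. x (Suc i) \<in> S}"
  have "c ` (pverts G - S) \<subseteq> (\<lambda>i. c (x i)) ` ?I"
  proof
    fix \<gamma> assume "\<gamma> \<in> c ` (pverts G - S)"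
    then obtain v where v: "v \<in> pverts G" "v \<notin> S" "c v = \<gamma>" by auto
    from v(1) obtain i where i: "i < m" "x i = v" unfolding x(3)[symmetric] by auto
    from S obtain w where w: "w \<in> S" by auto
    with S(1) obtain j where j: "j < m" "x j = w" unfolding x(3)[symmetric] by blast
    \<comment> \<open>Walk on from \<open>v\<close> until \<open>S\<close> is first met, which
      happens because \<open>S\<close> is nonempty and the cycle visits all of it. Adding
      \<open>m\<close> in the distance \<open>j + m - i\<close> keeps the subtraction from being
      truncated.\<close>
    define k where "k = (LEAST k. x (i + k) \<in> S)"
    have "x (i + (j + m - i)) = w" using i j x(5)[of j] by simp
    then have k: "x (i + k) \<in> S" unfolding k_def
      using w by (intro LeastI[of "\<lambda>k. x (i + k) \<in> S" "j + m - i"]) simp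
    have least: "x (i + l) \<notin> S" if "l < k" for l
      using not_less_Least that unfolding k_def by blast
    have col: "c (x (i + l)) = \<gamma>" if "l < k" for l
      using that
    proof (induction l)
      case 0
      then show ?case using i v by simp
    next
      case (Suc l)
      then show ?case
        using colour[OF x(2)[of "i + l"]] least[of l] least[of "Suc l"] by simp
    qed
    have "k \<noteq> 0" using k i v by (intro notI) simp
    then obtain l where l: "k = Suc l" using not0_implies_Suc by blast
    \<comment> \<open>The position just before the entry into \<open>S\<close>, brought back into
      one period, still has the colour of \<open>v\<close>.\<close>
    let ?t = "(i + l) mod m"
    have "x (Suc ?t) = x (i + k)" 
      using x_mod[of "Suc ?t"] x_mod[of "Suc (i + l)"] by (simp add: mod_Suc_eq l)
    with k m have "?t \<in> ?I" by simp
    moreover have "c (x ?t) = \<gamma>" using col[of l] l by (simp add: x_mod)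
    ultimately show "\<gamma> \<in> (\<lambda>i. c (x i)) ` ?I" by blast
  qed
  then have "card (c ` (pverts G - S)) \<le> card ?I"
    by (rule surj_card_le [rotated]) simp
  also have "\<dots> \<le> card S"
  proof (rule card_inj_on_le)
    show "inj_on (\<lambda>i. x (Suc i)) ?I" using x(4) by (rule inj_on_subset) auto
  qed (use S in auto)
  finally show ?thesis .
qed

section \<open>Permuting subgroups of the dihedral group\<close>

text \<open>The generator \<open>d\<close> is the least positive element, which exists because
  \<open>n\<close> is one; division with remainder by \<open>d\<close> leaves nothing else.\<close>

lemma int_subgroup_eq_multiples:
  fixes D :: "int set"
  assumes "n > 0" "int n \<in> D" and diff: "\<And>x y. x \<in> D \<Longrightarrow> y \<in> D \<Longrightarrow> x - y \<in> D"
  obtains d :: nat where "d > 0" "D = {x. int d dvd x}"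
proof -
  define d where "d = (LEAST d. d > 0 \<and> int d \<in> D)"
  have "d > 0 \<and> int d \<in> D"
    unfolding d_def by (rule LeastI[of _ n]) (use assms in simp)
  then have d: "d > 0" "int d \<in> D" by auto
  have zero: "0 \<in> D" using diff[OF d(2) d(2)] by simp
  have mult: "k * int d \<in> D" for k
  proof (induction k rule: int_induct[where k = 0])
    case base
    show ?case using zero by simp
  next
    case (step1 k)
    show ?case using diff[OF step1(2) diff[OF zero d(2)]] by (simp add: algebra_simps)
  next
    case (step2 k)
    show ?case using diff[OF step2(2) d(2)] by (simp add: algebra_simps)
  qed
  have "D = {x. int d dvd x}"
  proof (intro equalityI subsetI CollectI)
    fix x assume "x \<in> D"
    have "x mod int d \<in> D"
      using diff[OF \<open>x \<in> D\<close> mult[of "x div int d"]] by (simp add: minus_div_mult_eq_mod)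
    moreover have "nat (x mod int d) < d"
      using d(1) by (simp add: nat_less_iff)
    moreover have "0 \<le> x mod int d"
      using d(1) by simp
    moreover have "\<not> 0 < x mod int d"
      using calculation not_less_Least[of "nat (x mod int d)" "\<lambda>d. d > 0 \<and> int d \<in> D"]
      unfolding d_def[symmetric] by auto
    ultimately have "x mod int d = 0" by linarith
    then show "int d dvd x" by (simp add: dvd_eq_mod_eq_0)
  next
    fix x assume "x \<in> {x. int d dvd x}"
    then show "x \<in> D" using mult by (auto simp: dvd_def mult.commute)
  qed
  with d(1) show ?thesis by (rule that)
qed

text \<open>Factors move past each other by \<open>h k = (h k h^-1) h\<close> and
  \<open>k h = h (h^-1 k h)\<close>.\<close>

lemma (in group) set_mult_commute_if_normalizes:
  assumes H: "subgroup H G" and K: "K \<subseteq> carrier G"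
    and conj: "\<And>h k. h \<in> H \<Longrightarrow> k \<in> K \<Longrightarrow> h \<otimes> k \<otimes> inv h \<in> K"
  shows "H <#> K = K <#> H"
proof (intro equalityI subsetI)
  fix x assume "x \<in> H <#> K"
  then obtain h k where hk: "h \<in> H" "k \<in> K" "x = h \<otimes> k" by (auto simp: set_mult_def)
  moreover have "h \<in> carrier G" "k \<in> carrier G" using hk H K by (auto dest: subgroup.subset)
  ultimately have "x = (h \<otimes> k \<otimes> inv h) \<otimes> h" by (simp add: m_assoc)
  then show "x \<in> K <#> H" using hk conj by (auto simp: set_mult_def)
next
  fix x assume "x \<in> K <#> H"
  then obtain h k where hk: "h \<in> H" "k \<in> K" "x = k \<otimes> h" by (auto simp: set_mult_def)
  moreover have "h \<in> carrier G" "k \<in> carrier G" using hk H K by (auto dest: subgroup.subset)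
  ultimately have "x = h \<otimes> (inv h \<otimes> k \<otimes> inv (inv h))" by (simp add: m_assoc flip: m_assoc[of h])
  moreover have "inv h \<otimes> k \<otimes> inv (inv h) \<in> K"
    using hk conj H by (blast intro: subgroup.m_inv_closed)
  ultimately show "x \<in> H <#> K" using hk by (auto simp: set_mult_def)
qed

text \<open>\<open>Inl d\<close> stands for \<open>\<langle>a\<^sup>d\<rangle>\<close> and \<open>Inr (d, i)\<close> for \<open>\<langle>a\<^sup>d, a\<^sup>ib\<rangle>\<close>.\<close>

type_synonym subgroup_code = "nat + nat \<times> nat"

text \<open>The excluded codes are those of the trivial subgroup, \<open>Inl n\<close>, and of the
  whole group, \<open>Inr (1, 0)\<close>. The bound on \<open>i\<close> picks one code per subgroup,
  since \<open>i\<close> matters only modulo \<open>d\<close>.\<close>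

definition subgroup_codes :: "nat \<Rightarrow> subgroup_code set" where
  "subgroup_codes n = Inl ` {d. d dvd n \<and> d \<noteq> n} \<union> Inr ` (SIGMA d:{d. d dvd n \<and> d \<noteq> 1}. {..<d})"

text \<open>A sufficient condition only: \<open>d\<close> and \<open>e\<close> need not be comparable for the subgroups to permute.\<close>

fun codes_permute :: "subgroup_code \<Rightarrow> subgroup_code \<Rightarrow> bool" where
  "codes_permute (Inl d) c \<longleftrightarrow> True"
| "codes_permute c (Inl e) \<longleftrightarrow> True"
| "codes_permute (Inr (d, i)) (Inr (e, j)) \<longleftrightarrow>
     (e dvd d \<and> int e dvd 2 * (int i - int j)) \<or> (d dvd e \<and> int d dvd 2 * (int j - int i))"

section \<open>Classification of the subgroups\<close>

context dihedral
begin

definition rot_subgroup :: "nat \<Rightarrow> 'a set" where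
  "rot_subgroup d = rot ` {x. int d dvd x}"

definition dih_subgroup :: "nat \<Rightarrow> nat \<Rightarrow> 'a set" where
  "dih_subgroup d i = rot_subgroup d \<union> ref ` {x. int d dvd x - int i}"

definition decode :: "subgroup_code \<Rightarrow> 'a set" where
  "decode c = (case c of Inl d \<Rightarrow> rot_subgroup d | Inr (d, i) \<Rightarrow> dih_subgroup d i)"

lemmas mult_simps = rot_rot rot_ref ref_rot ref_ref

lemma rot_closed [simp]: "rot i \<in> carrier G" and ref_closed [simp]: "ref i \<in> carrier G"
  by (auto simp: carrier_eq)

lemma ref_neq_rot: "ref i \<noteq> rot j"
  using rot_neq_ref by metis

lemma one_eq: "\<one> = rot 0"
  using l_cancel_one[of "rot 0" "rot 0"] by (simp add: rot_rot)

lemma inv_rot: "inv (rot i) = rot (- i)" and inv_ref: "inv (ref i) = ref i"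
  by (rule inv_equality; simp add: mult_simps one_eq)+

lemma dih_subgroup_rotI: "int d dvd x \<Longrightarrow> rot x \<in> dih_subgroup d i"
  and dih_subgroup_refI: "int d dvd x - int i \<Longrightarrow> ref x \<in> dih_subgroup d i"
  by (simp_all add: dih_subgroup_def rot_subgroup_def)

lemma dih_subgroup_cases:
  assumes "g \<in> dih_subgroup d i"
  obtains (rot) x where "g = rot x" "int d dvd x"
  | (ref) x where "g = ref x" "int d dvd x - int i"
  using assms unfolding dih_subgroup_def rot_subgroup_def by blast

text \<open>An exponent is determined by its rotation only modulo \<open>n\<close>; since
  \<open>d\<close> divides \<open>n\<close>, the condition does not depend on the exponent
  chosen.\<close>

lemma rot_mem_rot_subgroup:
  assumes "d dvd n"
  shows "rot x \<in> rot_subgroup d \<longleftrightarrow> int d dvd x"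
proof
  assume "rot x \<in> rot_subgroup d"
  then obtain y where y: "int d dvd y" "rot x = rot y"
    unfolding rot_subgroup_def by blast
  then have "int n dvd x - y" by (simp add: rot_eq_iff)
  with assms y(1) have "int d dvd (x - y) + y"
    by (meson dvd_add dvd_trans int_dvd_int_iff)
  then show "int d dvd x" by simp
qed (auto simp: rot_subgroup_def)

lemma ref_notin_rot_subgroup: "ref x \<notin> rot_subgroup d"
  by (auto simp: rot_subgroup_def ref_neq_rot)

lemma rot_mem_dih_subgroup: "d dvd n \<Longrightarrow> rot x \<in> dih_subgroup d i \<longleftrightarrow> int d dvd x"
  by (auto simp: dih_subgroup_def rot_mem_rot_subgroup rot_neq_ref)

lemma ref_mem_dih_subgroup:
  assumes "d dvd n"
  shows "ref x \<in> dih_subgroup d i \<longleftrightarrow> int d dvd x - int i"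
proof
  assume "ref x \<in> dih_subgroup d i"
  then obtain y where y: "int d dvd y - int i" "ref x = ref y"
    by (cases rule: dih_subgroup_cases) (simp_all add: ref_neq_rot that)
  then have "int n dvd x - y" by (simp add: ref_eq_iff)
  with assms y(1) have "int d dvd (x - y) + (y - int i)"
    by (meson dvd_add dvd_trans int_dvd_int_iff)
  then show "int d dvd x - int i" by simp
qed (auto simp: dih_subgroup_def)

lemmas mem_simps =
  rot_mem_rot_subgroup ref_notin_rot_subgroup rot_mem_dih_subgroup ref_mem_dih_subgroup

lemma subgroup_rot_subgroup: "subgroup (rot_subgroup d) G"
proof (rule subgroupI)
  show "rot_subgroup d \<noteq> {}" unfolding rot_subgroup_def using dvd_0_right by blast
qed (auto simp: rot_subgroup_def inv_rot rot_rot)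

lemma subgroup_dih_subgroup: "subgroup (dih_subgroup d i) G"
proof (rule subgroupI)
  show "dih_subgroup d i \<noteq> {}"
    unfolding dih_subgroup_def rot_subgroup_def using dvd_0_right by blast
next
  fix x assume "x \<in> dih_subgroup d i"
  then show "inv x \<in> dih_subgroup d i"
    by (auto simp: dih_subgroup_def rot_subgroup_def inv_rot inv_ref)
next
  fix x y assume xy: "x \<in> dih_subgroup d i" "y \<in> dih_subgroup d i"
  have 1: "int d dvd u + v - int i" if "int d dvd u" "int d dvd v - int i" for u v
    using dvd_add[OF that] by (simp add: algebra_simps)
  have 2: "int d dvd u - v - int i" if "int d dvd u - int i" "int d dvd v" for u v
    using dvd_diff[OF that] by (simp add: algebra_simps)
  have 3: "int d dvd u - v" if "int d dvd u - int i" "int d dvd v - int i" for u v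
    using dvd_diff[OF that] by simp
  from xy(1) show "x \<otimes> y \<in> dih_subgroup d i"
  proof (cases rule: dih_subgroup_cases)
    case (rot u)
    from xy(2) show ?thesis
      by (cases rule: dih_subgroup_cases)
        (simp_all add: rot mult_simps dih_subgroup_rotI dih_subgroup_refI 1)
  next
    case (ref u)
    from xy(2) show ?thesis
      by (cases rule: dih_subgroup_cases)
        (simp_all add: ref mult_simps dih_subgroup_rotI dih_subgroup_refI 2 3)
  qed
qed (auto simp: dih_subgroup_def rot_subgroup_def)

text \<open>The exponents of the rotations in \<open>H\<close> form a subgroup of the integers
  containing \<open>n\<close>, hence the multiples of a divisor \<open>d\<close> of
  \<open>n\<close>. Multiplying by one fixed reflection of \<open>H\<close> shows that the
  reflections, if any, form a single residue class modulo \<open>d\<close>.\<close>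

lemma subgroup_cases:
  assumes "subgroup H G"
  obtains d where "d dvd n" "H = rot_subgroup d"
  | d i where "d dvd n" "i < d" "H = dih_subgroup d i"
proof -
  interpret H: subgroup H G by fact
  have elem: "(\<exists>i. x = rot i) \<or> (\<exists>i. x = ref i)" if "x \<in> H" for x
    using H.subset that by (auto simp: carrier_eq)
  have "rot (int n) = rot 0" by (simp add: rot_eq_iff)
  then have n: "rot (int n) \<in> H" using H.one_closed by (simp add: one_eq)
  have "rot (x - y) \<in> H" if "rot x \<in> H" "rot y \<in> H" for x y
    using H.m_closed[OF that(1) H.m_inv_closed[OF that(2)]] by (simp add: inv_rot rot_rot)
  with n n_pos obtain d where d: "d > 0" "{x. rot x \<in> H} = {x. int d dvd x}"
    using int_subgroup_eq_multiples[of n "{x. rot x \<in> H}"] by blast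
  then have rot_H: "rot x \<in> H \<longleftrightarrow> int d dvd x" for x by blast
  have dn: "d dvd n" using n rot_H by simp
  show ?thesis
  proof (cases "\<exists>j. ref j \<in> H")
    case False
    have "H = rot_subgroup d"
    proof (intro equalityI subsetI)
      fix g assume "g \<in> H"
      moreover from this elem False obtain x where "g = rot x" by blast
      ultimately show "g \<in> rot_subgroup d" by (simp add: rot_H rot_subgroup_def)
    next
      fix g assume "g \<in> rot_subgroup d"
      with rot_H show "g \<in> H" by (auto simp: rot_subgroup_def)
    qed
    with dn show ?thesis by (rule that(1))
  next
    case True
    then obtain j where j: "ref j \<in> H" by blast
    have ref_H: "ref x \<in> H \<longleftrightarrow> int d dvd x - j" for x
    proof
      assume "ref x \<in> H"
      from H.m_closed[OF this j] show "int d dvd x - j" by (simp add: ref_ref rot_H)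
    next
      assume "int d dvd x - j"
      then have "rot (x - j) \<in> H" by (simp add: rot_H)
      from H.m_closed[OF this j] show "ref x \<in> H" by (simp add: rot_ref)
    qed
    define i where "i = nat (j mod int d)"
    have "int i = j mod int d" using d(1) by (simp add: i_def)
    then have "int d dvd x - j \<longleftrightarrow> int d dvd x - int i" for x
      by (simp add: mod_eq_dvd_iff[symmetric])
    with ref_H have ref_H: "ref x \<in> H \<longleftrightarrow> int d dvd x - int i" for x by simp
    have "H = dih_subgroup d i"
    proof (intro equalityI subsetI)
      fix g assume "g \<in> H"
      from elem[OF this] this show "g \<in> dih_subgroup d i"
        by (elim disjE exE) (simp_all add: rot_H ref_H dih_subgroup_rotI dih_subgroup_refI)
    next
      fix g assume "g \<in> dih_subgroup d i"
      then show "g \<in> H" by (cases rule: dih_subgroup_cases) (simp_all add: rot_H ref_H)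
    qed
    moreover have "i < d" using d(1) by (simp add: i_def nat_less_iff)
    ultimately show ?thesis using dn by (intro that(2))
  qed
qed

lemma pverts_eq: "pverts (permuting_subgroups_graph G) = decode ` subgroup_codes n"
proof -
  have triv: "rot_subgroup n = {\<one>}"
    by (auto simp: rot_subgroup_def one_eq rot_eq_iff image_iff)
  have full: "dih_subgroup 1 0 = carrier G"
    by (auto simp: dih_subgroup_def rot_subgroup_def carrier_eq)
  have "H \<in> decode ` subgroup_codes n" if "subgroup H G" "H \<noteq> {\<one>}" "H \<noteq> carrier G" for H
    using that(1)
  proof (cases rule: subgroup_cases)
    case (1 d)
    with that triv have "Inl d \<in> subgroup_codes n" by (auto simp: subgroup_codes_def)
    with 1 show ?thesis by (force simp: decode_def)
  next
    case (2 d i)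
    have "d \<noteq> 1" using 2 that(3) full by auto
    with 2 have "Inr (d, i) \<in> subgroup_codes n" by (auto simp: subgroup_codes_def)
    with 2 show ?thesis by (force simp: decode_def)
  qed
  moreover have "subgroup (rot_subgroup d) G \<and> rot_subgroup d \<noteq> {\<one>} \<and> rot_subgroup d \<noteq> carrier G"
    if d: "d dvd n" "d \<noteq> n" for d
  proof -
    have "\<not> int n dvd int d" using d by (auto dest: dvd_antisym)
    then have "rot (int d) \<noteq> \<one>" by (simp add: one_eq rot_eq_iff)
    moreover have "rot (int d) \<in> rot_subgroup d" by (simp add: rot_subgroup_def)
    ultimately show ?thesis
      using subgroup_rot_subgroup ref_notin_rot_subgroup[of 0 d] ref_closed[of 0] by blast
  qed
  moreover have "subgroup (dih_subgroup d i) G \<and> dih_subgroup d i \<noteq> {\<one>} \<and> dih_subgroup d i \<noteq> carrier G"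
    if d: "d dvd n" "d \<noteq> 1" for d i
  proof -
    have "ref (int i) \<in> dih_subgroup d i" by (simp add: dih_subgroup_def)
    moreover have "rot 1 \<notin> dih_subgroup d i" using d by (simp add: mem_simps)
    ultimately show ?thesis
      using subgroup_dih_subgroup rot_closed[of 1] ref_neq_rot[of "int i" 0] unfolding one_eq by blast
  qed
  ultimately show ?thesis
    by (auto simp: permuting_subgroups_graph_def Let_def subgroup_codes_def decode_def)
qed

text \<open>The rotations of a subgroup determine \<open>d\<close>, its reflections determine
  \<open>i\<close> modulo \<open>d\<close>, and containing a reflection separates the two
  kinds.\<close>

lemma inj_on_decode: "inj_on decode (subgroup_codes n)"
proof -
  have rot: "d = e" if "d dvd n" "e dvd n" "\<And>x. rot x \<in> H \<longleftrightarrow> int d dvd x" "\<And>x. rot x \<in> H \<longleftrightarrow> int e dvd x"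
    for d e H
    using that(3,4)[of "int d"] that(3,4)[of "int e"] by (simp add: dvd_antisym)
  have 1: "d = e" if "d dvd n" "e dvd n" "rot_subgroup d = rot_subgroup e" for d e
    using that(1,2) rot_mem_rot_subgroup[OF that(1)] rot_mem_rot_subgroup[OF that(2), folded that(3)]
    by (rule rot)
  have 2: "d = e \<and> i = j" if "d dvd n" "e dvd n" "i < d" "j < e" "dih_subgroup d i = dih_subgroup e j" for d e i j
  proof -
    have de: "d = e"
      using that(1,2) rot_mem_dih_subgroup[OF that(1), of _ i]
        rot_mem_dih_subgroup[OF that(2), of _ j, folded that(5)]
      by (rule rot)
    have "ref (int i) \<in> dih_subgroup e j"
      using that(1,5) by (simp add: mem_simps flip: that(5))
    then have "int d dvd int i - int j" using that(1,2) by (simp add: mem_simps de)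
    then have "i mod d = j mod d"
      by (simp add: mod_eq_dvd_iff[symmetric] flip: zmod_int)
    with that de show ?thesis by simp
  qed
  have 3: "rot_subgroup d \<noteq> dih_subgroup e j" for d e j
    using ref_notin_rot_subgroup[of "int j" d] by (auto simp: dih_subgroup_def)
  show ?thesis
    by (rule inj_onI) (auto simp: subgroup_codes_def decode_def simp: 3 3[symmetric] dest: 1 2)
qed

section \<open>Permutability of subgroups\<close>

lemma rot_subgroup_permutes:
  assumes "subgroup H G"
  shows "H <#> rot_subgroup d = rot_subgroup d <#> H"
proof (rule set_mult_commute_if_normalizes[OF assms])
  show "rot_subgroup d \<subseteq> carrier G" by (auto simp: rot_subgroup_def)
  fix h k assume "h \<in> H" "k \<in> rot_subgroup d"
  then show "h \<otimes> k \<otimes> inv h \<in> rot_subgroup d"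
    using subgroup.subset[OF assms]
    by (auto simp: rot_subgroup_def carrier_eq mult_simps inv_rot inv_ref dest!: subsetD)
qed

text \<open>The first subgroup normalizes the second. Conjugating a reflection of exponent
  \<open>y\<close> by \<open>a^x\<close> gives exponent \<open>2 * x + y\<close>, and conjugating it
  by \<open>a^x b\<close> gives \<open>2 * x - y\<close>; modulo \<open>e\<close> the latter is
  \<open>2 * i - j\<close>, which is \<open>j\<close> by hypothesis.\<close>

lemma dih_subgroups_permute:
  assumes e: "e dvd d" "int e dvd 2 * (int i - int j)"
  shows "dih_subgroup d i <#> dih_subgroup e j = dih_subgroup e j <#> dih_subgroup d i"
proof (rule set_mult_commute_if_normalizes[OF subgroup_dih_subgroup])
  show "dih_subgroup e j \<subseteq> carrier G" by (auto simp: dih_subgroup_def rot_subgroup_def)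
  fix h k assume hk: "h \<in> dih_subgroup d i" "k \<in> dih_subgroup e j"
  have ed: "int e dvd x" if "int d dvd x" for x
    using e(1) that by (meson dvd_trans int_dvd_int_iff)
  have 1: "int e dvd 2 * x + y - int j" if "int d dvd x" "int e dvd y - int j" for x y
    using dvd_add[OF dvd_mult[OF ed[OF that(1)], of 2] that(2)] by (simp add: algebra_simps)
  have 2: "int e dvd 2 * x - y - int j" if "int d dvd x - int i" "int e dvd y - int j" for x y
  proof -
    have "int e dvd 2 * (x - int i) + 2 * (int i - int j) - (y - int j)"
      by (intro dvd_add dvd_diff e(2) that(2) dvd_mult ed[OF that(1)])
    then show ?thesis by (simp add: algebra_simps)
  qed
  show "h \<otimes> k \<otimes> inv h \<in> dih_subgroup e j"
    using hk(1)
  proof (cases rule: dih_subgroup_cases)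
    case (rot x)
    from hk(2) show ?thesis
      by (cases rule: dih_subgroup_cases)
        (auto simp: rot mult_simps inv_rot intro!: dih_subgroup_rotI dih_subgroup_refI 1)
  next
    case (ref x)
    from hk(2) show ?thesis
      by (cases rule: dih_subgroup_cases)
        (auto simp: ref mult_simps inv_ref intro!: dih_subgroup_rotI dih_subgroup_refI 2)
  qed
qed

text \<open>The product of the reflections of exponents \<open>i\<close> and \<open>j\<close> is the
  rotation of exponent \<open>i - j\<close>. Rewritten as a product in the opposite order, it comes
  either from two rotations, so that \<open>i - j\<close> vanishes modulo \<open>g\<close>, or from
  two reflections, so that \<open>i - j\<close> and \<open>j - i\<close> agree modulo
  \<open>g\<close>.\<close>

lemma dih_subgroups_permute_imp_dvd:
  assumes "dih_subgroup d i <#> dih_subgroup e j = dih_subgroup e j <#> dih_subgroup d i"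
    and g: "g dvd d" "g dvd e" "g dvd n"
  shows "int g dvd 2 * (int i - int j)"
proof -
  have gd: "int g dvd x" if "int d dvd x" for x using g(1) that by (meson dvd_trans int_dvd_int_iff)
  have ge: "int g dvd x" if "int e dvd x" for x using g(2) that by (meson dvd_trans int_dvd_int_iff)
  have gn: "int g dvd x" if "int n dvd x" for x using g(3) that by (meson dvd_trans int_dvd_int_iff)
  have "ref (int i) \<otimes> ref (int j) \<in> dih_subgroup d i <#> dih_subgroup e j"
    unfolding set_mult_def dih_subgroup_def by force
  then obtain k h where k: "k \<in> dih_subgroup e j" and h: "h \<in> dih_subgroup d i"
    and eq: "rot (int i - int j) = k \<otimes> h"
    unfolding assms(1) by (auto simp: set_mult_def ref_ref)
  consider x y where "k = rot x" "h = rot y" "int e dvd x" "int d dvd y"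
    | x y where "k = ref x" "h = ref y" "int e dvd x - int j" "int d dvd y - int i"
    using k h eq
    by (auto simp: dih_subgroup_def rot_subgroup_def mult_simps rot_neq_ref)
  then show ?thesis
  proof cases
    case 1
    then have "int g dvd int i - int j - (x + y)" using eq gn by (simp add: rot_rot rot_eq_iff)
    with 1 have "int g dvd (int i - int j - (x + y)) + (x + y)"
      by (intro dvd_add) (auto intro: gd ge)
    then have "int g dvd int i - int j" by simp
    then show ?thesis by (rule dvd_mult)
  next
    case 2
    then have "int g dvd int i - int j - (x - y)" using eq gn by (simp add: ref_ref rot_eq_iff)
    from dvd_diff[OF dvd_add[OF this ge[OF 2(3)]] gd[OF 2(4)]]
    show ?thesis by (simp add: algebra_simps)
  qed
qed

section \<open>Adjacency in terms of codes\<close>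

lemma parcs_iff:
  "(H, K) \<in> parcs (permuting_subgroups_graph G) \<longleftrightarrow>
     H \<in> decode ` subgroup_codes n \<and> K \<in> decode ` subgroup_codes n \<and> H \<noteq> K \<and> H <#> K = K <#> H"
  unfolding pverts_eq[symmetric] by (auto simp: permuting_subgroups_graph_def Let_def)

lemma codes_permute_imp_arc:
  assumes "codes_permute x y" "x \<noteq> y" "x \<in> subgroup_codes n" "y \<in> subgroup_codes n"
  shows "(decode x, decode y) \<in> parcs (permuting_subgroups_graph G)"
proof -
  have "decode x <#> decode y = decode y <#> decode x"
    using assms(1)
  proof (induction x y rule: codes_permute.induct)
    case (1 d c)
    show ?case
      by (auto simp: decode_def rot_subgroup_permutes subgroup_rot_subgroup subgroup_dih_subgroup
          split: sum.split)
  next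
    case (2 p e)
    show ?case
      by (auto simp: decode_def rot_subgroup_permutes subgroup_rot_subgroup subgroup_dih_subgroup
          split: prod.split)
  next
    case (3 d i e j)
    then show ?case
      by (auto simp: decode_def dih_subgroups_permute dih_subgroups_permute[symmetric])
  qed
  with assms show ?thesis
    using inj_on_decode by (auto simp: parcs_iff dest: inj_onD)
qed

text \<open>Reduces Hamiltonicity to a check on a list of codes, which for a fixed \<open>n\<close>
  is pure computation.\<close>

lemma hamiltonian_codesI:
  assumes cs: "distinct cs" "set cs = subgroup_codes n" "length cs \<ge> 3"
    and path: "successively codes_permute cs" and closing: "codes_permute (last cs) (hd cs)"
  shows "hamiltonian (permuting_subgroups_graph G)"
proof (rule hamiltonianI[of "map decode cs"])
  have ne: "cs \<noteq> []" using cs(3) by auto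
  show "distinct (map decode cs)" using cs inj_on_decode by (simp add: distinct_map)
  show "set (map decode cs) = pverts (permuting_subgroups_graph G)" using cs by (simp add: pverts_eq)
  show "3 \<le> length (map decode cs)" using cs by simp
  show "successively (\<lambda>x y. (x, y) \<in> parcs (permuting_subgroups_graph G)) (map decode cs)"
    unfolding successively_map unfolding successively_conv_nth
  proof (intro allI impI)
    fix i assume i: "Suc i < length cs"
    show "(decode (cs ! i), decode (cs ! Suc i)) \<in> parcs (permuting_subgroups_graph G)"
      using successively_nth[OF path i] i cs(1)
      by (intro codes_permute_imp_arc) (simp_all add: nth_eq_iff_index_eq flip: cs(2))
  qed
  have "last cs \<noteq> hd cs"
    using ne cs(1,3) by (simp add: last_conv_nth hd_conv_nth nth_eq_iff_index_eq)
  then have "(decode (last cs), decode (hd cs)) \<in> parcs (permuting_subgroups_graph G)"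
    using ne by (intro codes_permute_imp_arc closing) (simp_all flip: cs(2))
  then show "(last (map decode cs), hd (map decode cs)) \<in> parcs (permuting_subgroups_graph G)"
    using ne by (simp add: last_map hd_map)
qed

end

section \<open>Hamiltonicity for particular \<open>n\<close>\<close>

lemma divisors_prime_mult:
  fixes p q :: nat
  assumes "prime p" "prime q"
  shows "{d. d dvd p * q} = {1, p, q, p * q}"
proof (intro equalityI subsetI)
  fix d assume "d \<in> {d. d dvd p * q}"
  then have d: "d dvd p * q" by simp
  show "d \<in> {1, p, q, p * q}"
  proof (cases "p dvd d")
    case True
    then obtain k where k: "d = p * k" by blast
    with d assms(1) have "k dvd q" by (simp add: prime_gt_0_nat)
    with assms(2) have "k = 1 \<or> k = q" by (auto simp: prime_nat_iff)
    with k show ?thesis by auto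
  next
    case False
    with assms(1) have "coprime d p" by (metis prime_imp_coprime coprime_commute)
    with d have "d dvd q" by (simp add: coprime_dvd_mult_right_iff)
    with assms(2) show ?thesis by (auto simp: prime_nat_iff)
  qed
qed auto

lemma finite_subgroup_codes: "n > 0 \<Longrightarrow> finite (subgroup_codes n)"
  unfolding subgroup_codes_def by (intro finite_UnI finite_imageI finite_SigmaI) auto

text \<open>\<open>?L\<close> codes the \<open>n\<close> subgroups of order 2. They are pairwise
  nonadjacent for odd \<open>n\<close>, so the identity serves as a colouring and \<open>n\<close>
  is at most the number of other vertices. A proper divisor \<open>d\<close> contributes one
  rotation subgroup and, unless \<open>d = 1\<close>, also \<open>d\<close> dihedral ones; the
  summand for \<open>d = 1\<close> counts one too many, which makes the bound strict.\<close>

lemma (in dihedral) card_le_if_hamiltonian: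
  assumes "hamiltonian (permuting_subgroups_graph G)" and "odd n" "n > 1"
  shows "n < (\<Sum>d | d dvd n \<and> d \<noteq> n. Suc d)"
proof -
  let ?\<Gamma> = "permuting_subgroups_graph G"
  let ?P = "{d. d dvd n \<and> d \<noteq> n}" and ?Q = "{d. d dvd n \<and> d \<noteq> n} - {1}"
  let ?L = "(\<lambda>i. Inr (n, i)) ` {..<n} :: subgroup_code set"
  let ?C = "Inl ` ?P \<union> Inr ` (SIGMA d:?Q. {..<d})"
  let ?S = "decode ` ?C"
  have codes: "subgroup_codes n = ?C \<union> ?L" and disj: "?C \<inter> ?L = {}"
    using assms(3) unfolding subgroup_codes_def by auto
  have fin: "finite ?P" using n_pos by simp
  then have finC: "finite ?C" by auto
  have diff: "pverts ?\<Gamma> - ?S = decode ` ?L"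
  proof -
    have "pverts ?\<Gamma> - ?S = decode ` (subgroup_codes n - ?C)"
      unfolding pverts_eq by (rule inj_on_image_set_diff[OF inj_on_decode, symmetric]) (auto simp: codes)
    also have "subgroup_codes n - ?C = ?L" using codes disj by auto
    finally show ?thesis .
  qed
  have "card (id ` (pverts ?\<Gamma> - ?S)) \<le> card ?S"
  proof (rule hamiltonian_card_le[OF assms(1)])
    show "?S \<subseteq> pverts ?\<Gamma>" unfolding pverts_eq codes by blast
    show "?S \<noteq> {}" using assms(3) by (auto intro: exI[of _ 1])
    show "finite ?S" using finC by blast
    fix x y assume arc: "(x, y) \<in> parcs ?\<Gamma>" and "x \<notin> ?S" "y \<notin> ?S"
    moreover have "x \<in> pverts ?\<Gamma>" "y \<in> pverts ?\<Gamma>"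
      using arc by (simp_all add: parcs_iff pverts_eq)
    ultimately have "x \<in> decode ` ?L" "y \<in> decode ` ?L"
      unfolding diff[symmetric] by (simp_all only: Diff_iff simp_thms)
    then obtain i j where i: "i < n" "x = dih_subgroup n i" and j: "j < n" "y = dih_subgroup n j"
      by (auto simp: decode_def)
    have "int n dvd 2 * (int i - int j)"
      using arc i j by (intro dih_subgroups_permute_imp_dvd[of n i n j n]) (auto simp: parcs_iff)
    moreover have "coprime (int n) 2" using assms(2) by simp
    ultimately have "int n dvd int i - int j" by (simp only: coprime_dvd_mult_right_iff)
    then have "i mod n = j mod n"
      by (simp add: mod_eq_dvd_iff[symmetric] flip: zmod_int)
    with i j show "id x = id y" by simp
  qed
  moreover have "card (decode ` ?L) = n"
  proof -
    have "card (decode ` ?L) = card ?L"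
      by (rule card_image, rule inj_on_subset[OF inj_on_decode]) (auto simp: codes)
    also have "\<dots> = n" by (simp add: card_image inj_on_def)
    finally show ?thesis .
  qed
  ultimately have "n \<le> card ?S" unfolding diff by simp
  also have "\<dots> \<le> card ?C" using finC by (rule card_image_le)
  also have "\<dots> \<le> card (Inl ` ?P :: subgroup_code set) + card (Inr ` (SIGMA d:?Q. {..<d}) :: subgroup_code set)"
    by (rule card_Un_le)
  also have "\<dots> = card ?P + (\<Sum>d\<in>?Q. d)"
    using fin by (simp add: card_image)
  also have "\<dots> < (\<Sum>d\<in>?P. Suc d)"
  proof -
    have "(\<Sum>d\<in>?P. Suc d) = (\<Sum>d\<in>?P. d) + card ?P"
      by (rule sum_Suc)
    also have "(\<Sum>d\<in>?P. d) = 1 + (\<Sum>d\<in>?Q. d)"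
      using fin assms(3) by (intro sum.remove) auto
    finally show ?thesis by simp
  qed
  finally show ?thesis .
qed

text \<open>\<open>?C\<close> codes the five vertices adjacent to all others. In each remaining
  subgroup all reflections have the same exponent modulo \<open>q\<close>, and adjacent ones share
  this residue, so it colours the rest with \<open>q\<close> colours.\<close>

lemma (in dihedral) le_5_if_hamiltonian:
  assumes "hamiltonian (permuting_subgroups_graph G)" and n: "n = 2 * q" and q: "prime q" "q > 2"
  shows "q \<le> 5"
proof -
  let ?\<Gamma> = "permuting_subgroups_graph G"
  let ?C = "{Inl 1, Inl 2, Inl q, Inr (2, 0), Inr (2, 1)} :: subgroup_code set"
  let ?S = "decode ` ?C"
  \<comment> \<open>The colour is read off from the subgroup itself, as the set of residues of its
    reflections; \<open>colour\<close> below shows that it is a singleton on the remaining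
    vertices.\<close>
  define c where "c H = {x mod int q | x. ref x \<in> H}" for H
  have div: "{d. d dvd n} = {1, 2, q, 2 * q}"
    unfolding n by (rule divisors_prime_mult) (use q in auto)
  have divs: "d dvd n \<longleftrightarrow> d \<in> {1, 2, q, 2 * q}" for d using div by blast
  have C: "?C \<subseteq> subgroup_codes n"
    using q by (auto simp: subgroup_codes_def divs n)
  have "odd q" using q by (metis prime_odd_nat)
  have rest: "\<exists>d i. H = dih_subgroup d i \<and> d dvd n \<and> q dvd d" if H: "H \<in> pverts ?\<Gamma>" "H \<notin> ?S" for H
  proof -
    obtain w where w: "H = decode w" "w \<in> subgroup_codes n"
      using H(1) unfolding pverts_eq by (rule imageE)
    with H(2) w(1) have "w \<notin> ?C" by blast
    with w(2) obtain d i where di: "w = Inr (d, i)" "d dvd n" "d \<noteq> 1" "i < d"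
      unfolding subgroup_codes_def using divs n by auto
    moreover have "d \<noteq> 2"
      using di(4) \<open>w \<notin> ?C\<close> unfolding di(1) by (auto simp: less_2_cases_iff)
    ultimately show ?thesis using w(1) by (auto simp: decode_def divs)
  qed
  have colour: "c (dih_subgroup d i) = {int i mod int q}" if d: "d dvd n" "q dvd d" for d i
  proof -
    have key: "x mod int q = int i mod int q" if "int d dvd x - int i" for x
      using that d(2) by (metis dvd_trans int_dvd_int_iff mod_eq_dvd_iff)
    have "{x mod int q | x. int d dvd x - int i} \<subseteq> {int i mod int q}"
    proof clarify
      fix x assume "int d dvd x - int i"
      then show "x mod int q = int i mod int q" by (rule key)
    qed
    moreover have "c (dih_subgroup d i) = {x mod int q | x. int d dvd x - int i}"
      by (simp add: c_def ref_mem_dih_subgroup[OF d(1)])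
    moreover have "int i mod int q \<in> {x mod int q | x. int d dvd x - int i}"
      by (intro CollectI exI[of _ "int i"]) simp
    ultimately show ?thesis by (simp only: subset_singleton_iff) blast
  qed
  have "card (c ` (pverts ?\<Gamma> - ?S)) \<le> card ?S"
  proof (rule hamiltonian_card_le[OF assms(1)])
    show "?S \<subseteq> pverts ?\<Gamma>" unfolding pverts_eq using C by blast
    fix x y assume arc: "(x, y) \<in> parcs ?\<Gamma>" and "x \<notin> ?S" "y \<notin> ?S"
    then obtain d i e j where x: "x = dih_subgroup d i" "d dvd n" "q dvd d"
      and y: "y = dih_subgroup e j" "e dvd n" "q dvd e"
      using rest[of x] rest[of y] unfolding parcs_iff pverts_eq[symmetric] by blast
    have "int q dvd 2 * (int i - int j)"
      using arc x y n by (intro dih_subgroups_permute_imp_dvd[of d i e j q]) (auto simp: parcs_iff)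
    moreover have "coprime (int q) 2" using \<open>odd q\<close> by simp
    ultimately have "int q dvd int i - int j" by (simp only: coprime_dvd_mult_right_iff)
    then show "c x = c y" using x y by (simp add: colour mod_eq_dvd_iff)
  qed auto
  also have "card ?S \<le> card ?C" by (rule card_image_le) simp
  also have "card ?C \<le> 5" by (simp add: card_insert_if)
  finally have le: "card (c ` (pverts ?\<Gamma> - ?S)) \<le> 5" .
  \<comment> \<open>All \<open>q\<close> colours occur, already on the subgroups of order 4.\<close>
  have "(\<lambda>j. {int j}) ` {..<q} \<subseteq> c ` (pverts ?\<Gamma> - ?S)"
  proof
    fix X assume "X \<in> (\<lambda>j. {int j}) ` {..<q}"
    then obtain j where j: "j < q" "X = {int j}" by blast
    have w: "Inr (q, j) \<in> subgroup_codes n" "Inr (q, j) \<notin> ?C"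
      using q j by (auto simp: subgroup_codes_def divs)
    then have "decode (Inr (q, j)) \<in> pverts ?\<Gamma> - ?S"
      unfolding pverts_eq using inj_on_image_mem_iff[OF inj_on_decode w(1) C] by blast
    moreover have "c (decode (Inr (q, j))) = X"
      using j colour[of q j] by (simp add: decode_def divs)
    ultimately show "X \<in> c ` (pverts ?\<Gamma> - ?S)" by blast
  qed
  moreover have "finite (c ` (pverts ?\<Gamma> - ?S))"
    unfolding pverts_eq using finite_subgroup_codes[OF n_pos] by blast
  ultimately have "card ((\<lambda>j. {int j}) ` {..<q}) \<le> card (c ` (pverts ?\<Gamma> - ?S))"
    by (intro card_mono)
  with le show ?thesis by (simp add: card_image inj_on_def)
qed

section \<open>Explicit cycles for \<open>n = 6\<close> and \<open>n = 10\<close>\<close>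

lemma codes_permute_Inl [simp]: "codes_permute c (Inl e)"
  by (cases c) auto

lemma subgroup_codes_alt:
  "subgroup_codes n = Inl ` ({d. d dvd n} - {n}) \<union> Inr ` (SIGMA d:{d. d dvd n} - {1}. {..<d})"
  by (auto simp: subgroup_codes_def)

lemma Sigma_insert: "Sigma (insert x A) B = Pair x ` B x \<union> Sigma A B"
  by auto

text \<open>\<open>u\<close> is meant to be one of the five vertices adjacent to all others; it
  leads into the triangle of subgroups whose reflections have exponents congruent to
  \<open>j\<close> modulo \<open>q\<close>.\<close>

abbreviation block :: "nat \<Rightarrow> subgroup_code \<Rightarrow> nat \<Rightarrow> subgroup_code list" where
  "block q u j \<equiv> [u, Inr (2 * q, j), Inr (q, j), Inr (2 * q, j + q)]"

lemma (in dihedral) hamiltonian_6: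
  assumes "n = 6"
  shows "hamiltonian (permuting_subgroups_graph G)"
proof (rule hamiltonian_codesI)
  \<comment> \<open>The three triangles use up three of the five connecting vertices; the other two
    are adjacent to each other and close the cycle.\<close>
  let ?cs = "block 3 (Inl 1) 0 @ block 3 (Inl 2) 1 @ block 3 (Inl 3) 2 @ [Inr (2, 0), Inr (2, 1)]"
  have "{d :: nat. d dvd 6} = {1, 2, 3, 6}"
    using divisors_prime_mult[of 2 3] by simp
  then show "set ?cs = subgroup_codes n"
    unfolding assms subgroup_codes_alt
    by (simp add: insert_Diff_if lessThan_nat_numeral lessThan_Suc Sigma_insert) auto
qed simp_all

lemma (in dihedral) hamiltonian_10:
  assumes "n = 10"
  shows "hamiltonian (permuting_subgroups_graph G)"
proof (rule hamiltonian_codesI)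
  \<comment> \<open>Here the five triangles take exactly the five connecting vertices.\<close>
  let ?cs = "block 5 (Inl 1) 0 @ block 5 (Inl 2) 1 @ block 5 (Inl 5) 2
    @ block 5 (Inr (2, 0)) 3 @ block 5 (Inr (2, 1)) 4"
  have "{d :: nat. d dvd 10} = {1, 2, 5, 10}"
    using divisors_prime_mult[of 2 5] by simp
  then show "set ?cs = subgroup_codes n"
    unfolding assms subgroup_codes_alt
    by (simp add: insert_Diff_if lessThan_nat_numeral lessThan_Suc Sigma_insert) auto
qed simp_all

section \<open>The binary tree of dihedral subgroups for powers of 2\<close>

text \<open>A node \<open>(2 ^ k, i)\<close> stands for a residue class modulo \<open>2 ^ k\<close>,
  which splits into two classes modulo \<open>2 ^ Suc k\<close>. The list covers \<open>h\<close>
  levels below that node and omits the node itself, since the root \<open>(1, 0)\<close> is the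
  whole group.\<close>

fun preorder :: "nat \<Rightarrow> nat \<Rightarrow> nat \<Rightarrow> (nat \<times> nat) list" where
  "preorder 0 k i = []"
| "preorder (Suc h) k i =
     (2 ^ Suc k, i) # preorder h (Suc k) i @ (2 ^ Suc k, i + 2 ^ k) # preorder h (Suc k) (i + 2 ^ k)"

lemma mod_eq_iff_mod_double:
  fixes j m i :: nat
  assumes "i < m"
  shows "j mod m = i \<longleftrightarrow> j mod (2 * m) = i \<or> j mod (2 * m) = i + m"
proof -
  have "j mod (m * 2) = m * (j div m mod 2) + j mod m" by (rule mod_mult2_eq)
  moreover have "j div m mod 2 = 0 \<or> j div m mod 2 = 1" by auto
  ultimately have "j mod (2 * m) = j mod m \<or> j mod (2 * m) = m + j mod m"
    by (auto simp: mult.commute)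
  moreover have "j mod m < m" using assms by simp
  moreover have "r = i \<longleftrightarrow> s = i \<or> s = i + m" if "s = r \<or> s = m + r" "r < m" for r s
    using that assms by auto
  ultimately show ?thesis by blast
qed

lemma set_preorder:
  assumes "i < 2 ^ k"
  shows "set (preorder h k i) = {(2 ^ l, j) | l j. k < l \<and> l \<le> k + h \<and> j < 2 ^ l \<and> j mod 2 ^ k = i}"
  using assms
proof (induction h arbitrary: k i)
  case (Suc h)
  let ?T = "\<lambda>h k i. {(2 ^ l, j) | l j. k < l \<and> l \<le> k + h \<and> j < 2 ^ l \<and> j mod 2 ^ k = i} :: (nat \<times> nat) set"
  have mod: "j mod 2 ^ k = i \<longleftrightarrow> j mod 2 ^ Suc k = i \<or> j mod 2 ^ Suc k = i + 2 ^ k" for j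
    using mod_eq_iff_mod_double[OF Suc.prems] by simp
  have lt: "i < 2 ^ Suc k" "i + 2 ^ k < 2 ^ Suc k" using Suc.prems by simp_all
  \<comment> \<open>Level \<open>Suc k\<close> consists of the two children; everything deeper lies
    below one of them, according to its residue modulo \<open>2 ^ Suc k\<close>.\<close>
  have "?T (Suc h) k i = {(2 ^ Suc k, i), (2 ^ Suc k, i + 2 ^ k)} \<union> ?T h (Suc k) i \<union> ?T h (Suc k) (i + 2 ^ k)"
  proof (intro equalityI subsetI)
    fix z assume "z \<in> ?T (Suc h) k i"
    then obtain l j where z: "z = (2 ^ l, j)" "k < l" "l \<le> k + Suc h" "j < 2 ^ l" "j mod 2 ^ k = i" by blast
    show "z \<in> {(2 ^ Suc k, i), (2 ^ Suc k, i + 2 ^ k)} \<union> ?T h (Suc k) i \<union> ?T h (Suc k) (i + 2 ^ k)"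
    proof (cases "l = Suc k")
      case True
      with z(4) have "j mod 2 ^ Suc k = j" by simp
      with z(1,5) mod[of j] True show ?thesis by auto
    next
      case False
      with z(2,3) have "Suc k < l" "l \<le> Suc k + h" by simp_all
      with z(1,4,5) mod[of j] show ?thesis by blast
    qed
  next
    fix z assume "z \<in> {(2 ^ Suc k, i), (2 ^ Suc k, i + 2 ^ k)} \<union> ?T h (Suc k) i \<union> ?T h (Suc k) (i + 2 ^ k)"
    then consider "z = (2 ^ Suc k, i)" | "z = (2 ^ Suc k, i + 2 ^ k)"
      | l j where "z = (2 ^ l, j)" "Suc k < l" "l \<le> Suc k + h" "j < 2 ^ l"
          "j mod 2 ^ Suc k = i \<or> j mod 2 ^ Suc k = i + 2 ^ k" by blast
    then show "z \<in> ?T (Suc h) k i"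
    proof cases
      case 1
      then show ?thesis using lt Suc.prems by (intro CollectI exI[of _ "Suc k"] exI[of _ i]) simp
    next
      case 2
      then show ?thesis using lt Suc.prems by (intro CollectI exI[of _ "Suc k"] exI[of _ "i + 2 ^ k"]) simp
    next
      case (3 l j)
      with mod[of j] show ?thesis by (intro CollectI exI[of _ l] exI[of _ j]) simp
    qed
  qed
  with Suc.IH[OF lt(1)] Suc.IH[OF lt(2)] show ?case by simp
qed simp

lemma preorder_memD:
  assumes "(d, j) \<in> set (preorder h k i)" "i < 2 ^ k"
  shows "2 ^ Suc k dvd d" "j mod 2 ^ k = i"
  using assms by (auto simp: set_preorder simp del: power_Suc intro!: le_imp_power_dvd)

text \<open>Descendants have a larger modulus than their ancestors, and the two subtrees differ in
  the residue modulo \<open>2 ^ Suc k\<close>.\<close>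

lemma distinct_preorder: "i < 2 ^ k \<Longrightarrow> distinct (preorder h k i)"
proof (induction h arbitrary: k i)
  case (Suc h)
  have lt: "i < 2 ^ Suc k" "i + 2 ^ k < 2 ^ Suc k" using Suc.prems by simp_all
  have "(2 ^ Suc k, x) \<notin> set (preorder h (Suc k) y)" if "y < 2 ^ Suc k" for x y
  proof
    assume "(2 ^ Suc k, x) \<in> set (preorder h (Suc k) y)"
    from preorder_memD(1)[OF this that] have "Suc (Suc k) \<le> Suc k"
      by (rule power_dvd_imp_le) simp
    then show False by simp
  qed
  moreover have "set (preorder h (Suc k) i) \<inter> set (preorder h (Suc k) (i + 2 ^ k)) = {}"
    using preorder_memD(2)[OF _ lt(1)] preorder_memD(2)[OF _ lt(2)] by fastforce
  ultimately show ?case using Suc.IH[OF lt(1)] Suc.IH[OF lt(2)] lt by (simp del: power_Suc)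
qed simp

text \<open>The factor 2 in the permutability criterion gains one level: agreement modulo
  \<open>2 ^ k\<close> suffices for the modulus \<open>2 ^ Suc k\<close>. Hence a node also permutes
  with everything below its sibling.\<close>

lemma codes_permute_siblings:
  assumes "2 ^ Suc k dvd d" "j mod 2 ^ k = i mod 2 ^ k"
  shows "codes_permute (Inr (2 ^ Suc k, i)) (Inr (d, j))" "codes_permute (Inr (d, j)) (Inr (2 ^ Suc k, i))"
proof -
  have "int j mod 2 ^ k = int i mod 2 ^ k"
    using assms(2) by (metis of_nat_mod of_nat_numeral of_nat_power)
  then have "(2 :: int) ^ k dvd int j - int i" by (simp add: mod_eq_dvd_iff)
  then have "2 * 2 ^ k dvd 2 * (int j - int i)" by (rule mult_dvd_mono[OF dvd_refl])
  then have "int (2 ^ Suc k) dvd 2 * (int j - int i)" by simp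
  with assms(1) show "codes_permute (Inr (2 ^ Suc k, i)) (Inr (d, j))" "codes_permute (Inr (d, j)) (Inr (2 ^ Suc k, i))"
    by (simp_all del: power_Suc of_nat_power)
qed

text \<open>The subgroup \<open>Inr (2 ^ k, i)\<close> permutes with everything below it or its sibling in the binary tree of
  residues, so that the preorder traversal is a path.\<close>

lemma successively_preorder: "i < 2 ^ k \<Longrightarrow> successively codes_permute (map Inr (preorder h k i))"
proof (induction h arbitrary: k i)
  case (Suc h)
  have lt: "i < 2 ^ Suc k" "i + 2 ^ k < 2 ^ Suc k" using Suc.prems by simp_all
  have perm: "codes_permute (Inr (2 ^ Suc k, c)) (Inr z)" "codes_permute (Inr z) (Inr (2 ^ Suc k, c))"
    if "z \<in> set (preorder (Suc h) k i)" "c mod 2 ^ k = i" for z c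
  proof -
    obtain d j where z: "z = (d, j)" by (cases z)
    with that preorder_memD[of d j "Suc h" k i] Suc.prems
    show "codes_permute (Inr (2 ^ Suc k, c)) (Inr z)" "codes_permute (Inr z) (Inr (2 ^ Suc k, c))"
      unfolding z by (intro codes_permute_siblings; simp)+
  qed
  let ?l = "preorder h (Suc k) i" and ?r = "preorder h (Suc k) (i + 2 ^ k)"
  have sub: "set ?l \<subseteq> set (preorder (Suc h) k i)" "set ?r \<subseteq> set (preorder (Suc h) k i)"
    "(2 ^ Suc k, i + 2 ^ k) \<in> set (preorder (Suc h) k i)"
    by auto
  have i: "i mod 2 ^ k = i" "(i + 2 ^ k) mod 2 ^ k = i" using Suc.prems by simp_all
  have "codes_permute (Inr (2 ^ Suc k, i)) (Inr (hd ?l))" if "?l \<noteq> []"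
    using that sub i by (intro perm) auto
  \<comment> \<open>The step from the last node below the left child across to the right child; here
    permuting with the descendants of a sibling is essential.\<close>
  moreover have "codes_permute (Inr (last ?l)) (Inr (2 ^ Suc k, i + 2 ^ k))" if "?l \<noteq> []"
    using that sub i by (intro perm) auto
  moreover have "codes_permute (Inr (2 ^ Suc k, i + 2 ^ k)) (Inr (hd ?r))" if "?r \<noteq> []"
    using that sub i by (intro perm) auto
  moreover have "codes_permute (Inr (2 ^ Suc k, i)) (Inr (2 ^ Suc k, i + 2 ^ k))"
    using sub i by (intro perm)
  ultimately show ?case
    using Suc.IH[OF lt(1)] Suc.IH[OF lt(2)]
    by (cases "?l = []"; cases "?r = []")
      (simp_all add: successively_append_iff successively_Cons hd_append hd_map last_map
        del: power_Suc codes_permute.simps)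
qed simp

lemma (in dihedral) hamiltonian_power_of_2:
  assumes n: "n = 2 ^ \<alpha>" and "\<alpha> \<ge> 2"
  shows "hamiltonian (permuting_subgroups_graph G)"
proof (rule hamiltonian_codesI)
  \<comment> \<open>The traversal starts below the root, the residue 0 modulo 1. The rotation
    subgroups permute with everything, so they may follow in any order and lead back to the
    start.\<close>
  let ?cs = "map Inr (preorder \<alpha> 0 0) @ map (\<lambda>k. Inl (2 ^ k)) [0..<\<alpha>] :: subgroup_code list"
  have two: "prime (2 :: nat)" by simp
  have div: "d dvd n \<longleftrightarrow> (\<exists>k\<le>\<alpha>. d = 2 ^ k)" for d
    unfolding n by (rule divides_primepow_nat[OF two])
  from \<open>\<alpha> \<ge> 2\<close> obtain h where h: "\<alpha> = Suc h" by (cases \<alpha>) auto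
  show "distinct ?cs"
    by (auto simp: distinct_map distinct_preorder inj_on_def)
  have "{d. d dvd n \<and> d \<noteq> n} = (\<lambda>k. 2 ^ k) ` {..<\<alpha>}"
    unfolding n by (auto simp: divides_primepow_nat[OF two] order_less_le)
  moreover have "(SIGMA d:{d. d dvd n \<and> d \<noteq> 1}. {..<d}) = set (preorder \<alpha> 0 0)"
    by (auto simp: set_preorder div)
  ultimately show "set ?cs = subgroup_codes n"
    by (auto simp: subgroup_codes_def)
  show "length ?cs \<ge> 3" using \<open>\<alpha> \<ge> 2\<close> by (simp add: h)
  have "successively codes_permute (map (\<lambda>k. Inl (2 ^ k)) [0..<\<alpha>])"
    by (simp add: successively_conv_nth)
  then show "successively codes_permute ?cs"
    using \<open>\<alpha> \<ge> 2\<close> by (simp add: successively_append_iff successively_preorder hd_map)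
  show "codes_permute (last ?cs) (hd ?cs)"
    using \<open>\<alpha> \<ge> 2\<close> by (simp add: last_map)
qed

text \<open>For prime \<open>p\<close> the sum runs over the proper divisors of
  \<open>p ^ \<alpha>\<close>, so this contradicts the strict bound of
  \<open>card_le_if_hamiltonian\<close>. In the induction step the sum so far, the new power and
  \<open>1\<close> are each at most \<open>p ^ \<alpha>\<close>, whence the factor 3.\<close>

lemma sum_powers_le:
  fixes p :: nat
  assumes "p \<ge> 3"
  shows "(\<Sum>k<\<alpha>. Suc (p ^ k)) \<le> p ^ \<alpha>"
proof (induction \<alpha>)
  case (Suc \<alpha>)
  have "1 \<le> p ^ \<alpha>" using assms by simp
  with Suc have "(\<Sum>k<Suc \<alpha>. Suc (p ^ k)) \<le> 3 * p ^ \<alpha>" by simp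
  also have "\<dots> \<le> p ^ Suc \<alpha>" using assms by simp
  finally show ?case .
qed simp

section \<open>Prime powers and products of two primes\<close>

theorem theorem4p11:
  fixes n :: nat
  assumes "n \<ge> 3"
  shows "(\<forall>p \<alpha> :: nat. prime p \<and> \<alpha> \<ge> 1 \<and> n = p ^ \<alpha> \<longrightarrow>
            (hamiltonian (permuting_subgroups_graph (dihedral_group n)) \<longleftrightarrow> p = 2 \<and> \<alpha> \<ge> 2)) \<and>
         (\<forall>p q :: nat. prime p \<and> prime q \<and> p < q \<and> n = p * q \<longrightarrow>
            (hamiltonian (permuting_subgroups_graph (dihedral_group n)) \<longleftrightarrow> p = 2 \<and> q \<le> 5))"
proof -
  let ?H = "hamiltonian (permuting_subgroups_graph (dihedral_group n))"
  obtain rot ref where "dihedral (dihedral_group n) n rot ref"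
    using dihedral_dihedral_group[of n] assms by auto
  then interpret dihedral "dihedral_group n" n rot ref .
  have prime_power: "?H \<longleftrightarrow> p = 2 \<and> \<alpha> \<ge> 2" if p: "prime p" "\<alpha> \<ge> 1" and n: "n = p ^ \<alpha>" for p \<alpha>
  proof (cases "p = 2")
    case True
    \<comment> \<open>The value \<open>2 ^ 1\<close> is excluded by
      \<open>n \<ge> 3\<close>.\<close>
    have "\<alpha> \<noteq> 1" using assms n True by auto
    with p(2) have "\<alpha> \<ge> 2" by simp
    with True n hamiltonian_power_of_2[of \<alpha>] show ?thesis by simp
  next
    case False
    with p(1) have p3: "p \<ge> 3" using prime_ge_2_nat[of p] by simp
    with p(1) have "odd n" unfolding n using prime_odd_nat[of p] by simp
    have "{d. d dvd n \<and> d \<noteq> n} = (\<lambda>k. p ^ k) ` {..<\<alpha>}"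
      using p3 unfolding n by (auto simp: divides_primepow_nat[OF p(1)] order_less_le)
    moreover have "inj_on (\<lambda>k. p ^ k) {..<\<alpha>}" using p3 by (auto simp: inj_on_def)
    ultimately have "(\<Sum>d | d dvd n \<and> d \<noteq> n. Suc d) \<le> n"
      using sum_powers_le[OF p3, of \<alpha>] by (simp add: sum.reindex n)
    with card_le_if_hamiltonian \<open>odd n\<close> assms False show ?thesis by fastforce
  qed
  have prime_product: "?H \<longleftrightarrow> p = 2 \<and> q \<le> 5" if p: "prime p" "prime q" "p < q" and n: "n = p * q" for p q
  proof (cases "p = 2")
    case True
    have "odd q" using p True prime_odd_nat[of q] by simp
    then have "q \<noteq> 4" by auto
    have ?H if "q \<le> 5"
    proof -
      have "q = 3 \<or> q = 5" using that p(3) True \<open>q \<noteq> 4\<close> by auto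
      then show ?thesis using hamiltonian_6 hamiltonian_10 n True by auto
    qed
    moreover have "q \<le> 5" if ?H
      using le_5_if_hamiltonian[OF that, of q] n p True by simp
    ultimately show ?thesis using True by blast
  next
    case False
    then have p3: "p \<ge> 3" using prime_ge_2_nat[OF p(1)] by simp
    with p(3) have "q \<ge> 4" by simp
    \<comment> \<open>Writing \<open>p = 3 + u\<close> and \<open>q = 4 + v\<close> turns
      \<open>p + q + 4 \<le> p * q\<close> into a comparison of polynomials with nonnegative
      coefficients.\<close>
    then obtain v where v: "q = 4 + v" using le_Suc_ex by blast
    obtain u where u: "p = 3 + u" using p3 le_Suc_ex by blast
    have "odd n" using p p3 prime_odd_nat[of p] prime_odd_nat[of q] unfolding n by simp
    have "{d. d dvd n \<and> d \<noteq> n} = {d. d dvd p * q} - {n}" using n by auto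
    also have "\<dots> = {1, p, q}" unfolding divisors_prime_mult[OF p(1,2)] using p p3 n by auto
    finally have "(\<Sum>d | d dvd n \<and> d \<noteq> n. Suc d) = p + q + 4" using p3 p(3) by simp
    also have "\<dots> \<le> n" unfolding n u v by (simp add: algebra_simps)
    finally show ?thesis
      using card_le_if_hamiltonian \<open>odd n\<close> assms False by fastforce
  qed
  show ?thesis using prime_power prime_product by blast
qed

end
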